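(* Let $r\ge 2$ and let $G$ and $F$ be $r$-graphs. If $G$ is a subgraph of an $F$-iterated blowup, then there exists a constant $c>0$ depending only on $F$ and $G$ such that, for all sufficiently large $n$, $$f_{F,G}(n)\ge n^c.$$
   Context: An $r$-graph is an $r$-uniform hypergraph. An $r$-graph is $G$-free if it contains no (not necessarily induced) subgraph isomorphic to $G$. For $r$-graphs $F,G$ and an integer $n\ge 1$, $f_{F,G}(n)$ denotes the maximum integer $m$ such that every $n$-vertex $G$-free $r$-graph contains an $F$-free induced subgraph on $m$ vertices. For an $r$-graph $H$ and a vertex $v$ of $H$, $H(v,F)$ denotes the $r$-graph obtained from $H$ by adding $v(F)-1$ new vertices, each a copy of $v$ (i.e. for each edge $e$ of $H$ containing $v$ and each new vertex $u$, $(e\setminus\{v\})\cup\{u\}$ is an edge), such that these new vertices together with $v$ induce a copy of $F$. An $r$-graph $G$ is an $F$-iterated blowup if either $G=F$, or $G=H(v,F)$ for some $F$-iterated blowup $H$ and some vertex $v$ of $H$. Here $v(F)$ is the number of vertices of $F$. *)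

theory Defs
  imports Complex_Main
begin

type_synonym 'a hypergraph = "'a set \<times> 'a set set"

abbreviation verts :: "'a hypergraph \<Rightarrow> 'a set" where "verts \<equiv> fst"
abbreviation edges :: "'a hypergraph \<Rightarrow> 'a set set" where "edges \<equiv> snd"

definition rgraph :: "nat \<Rightarrow> 'a hypergraph \<Rightarrow> bool" where
  "rgraph r H \<longleftrightarrow> finite (verts H) \<and> (\<forall>e\<in>edges H. e \<subseteq> verts H \<and> card e = r)"

definition subgraph :: "'a hypergraph \<Rightarrow> 'a hypergraph \<Rightarrow> bool" where
  "subgraph K H \<longleftrightarrow> verts K \<subseteq> verts H \<and> edges K \<subseteq> edges H"

definition induced :: "'a hypergraph \<Rightarrow> 'a set \<Rightarrow> 'a hypergraph" where
  "induced H S = (S, {e \<in> edges H. e \<subseteq> S})"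

text \<open>
  The last conjunct is needed because \<open>\<phi>\<close> is unconstrained outside \<open>verts H\<close>; it holds for every
  \<open>r\<close>-graph.
\<close>
definition isomorphic :: "'a hypergraph \<Rightarrow> 'b hypergraph \<Rightarrow> bool" where
  "isomorphic H K \<longleftrightarrow>
     (\<exists>\<phi>. bij_betw \<phi> (verts H) (verts K) \<and> (\<lambda>e. \<phi> ` e) ` edges H = edges K \<and>
          (\<forall>e\<in>edges H. e \<subseteq> verts H))"

definition contains :: "'a hypergraph \<Rightarrow> 'b hypergraph \<Rightarrow> bool" where
  "contains H G \<longleftrightarrow> (\<exists>K. subgraph K H \<and> isomorphic K G)"

definition free_of :: "'b hypergraph \<Rightarrow> 'a hypergraph \<Rightarrow> bool" where
  "free_of G H \<longleftrightarrow> \<not> contains H G"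

text \<open>
  Every finite hypergraph has an isomorphic copy on a set of natural numbers, so it suffices to
  let the host hypergraph range over \<^typ>\<open>nat hypergraph\<close>. The bound \<open>m \<le> n\<close> is automatic as soon
  as some \<open>G\<close>-free \<open>r\<close>-graph on \<open>n\<close> vertices exists; it only makes the maximum well defined
  (with value \<open>n\<close>) when there is none, e.g. when \<open>G\<close> has no edges and \<open>n\<close> is large.
\<close>
definition f_max :: "nat \<Rightarrow> 'a hypergraph \<Rightarrow> 'b hypergraph \<Rightarrow> nat \<Rightarrow> nat" where
  "f_max r F G n =
     Max {m. m \<le> n \<and>
            (\<forall>H :: nat hypergraph. rgraph r H \<and> card (verts H) = n \<and> free_of G H \<longrightarrow>
               (\<exists>S\<subseteq>verts H. card S = m \<and> free_of F (induced H S)))}"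

text \<open>
  \<open>vertex_blowup H v F H'\<close> says that \<open>H'\<close> is a realisation of \<open>H(v,F)\<close>, which is determined only
  up to the choice of the new vertices \<open>W\<close> and of the copy of \<open>F\<close> (with edge set \<open>D\<close>) placed on
  \<open>W \<union> {v}\<close>.
\<close>
definition vertex_blowup ::
    "'v hypergraph \<Rightarrow> 'v \<Rightarrow> 'a hypergraph \<Rightarrow> 'v hypergraph \<Rightarrow> bool" where
  "vertex_blowup H v F H' \<longleftrightarrow>
     (\<exists>W D. finite W \<and> W \<inter> verts H = {} \<and> card W = card (verts F) - 1 \<and>
        D \<subseteq> Pow (insert v W) \<and>
        H' = (verts H \<union> W,
              edges H \<union> {insert u (e - {v}) |e u. e \<in> edges H \<and> v \<in> e \<and> u \<in> W} \<union> D) \<and>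
        isomorphic (induced H' (insert v W)) F)"

inductive iterated_blowup :: "'a hypergraph \<Rightarrow> 'v hypergraph \<Rightarrow> bool"
  for F :: "'a hypergraph" where
  base: "isomorphic H F \<Longrightarrow> iterated_blowup F H"
| step: "iterated_blowup F H \<Longrightarrow> v \<in> verts H \<Longrightarrow> vertex_blowup H v F H' \<Longrightarrow> iterated_blowup F H'"

end

theory Submission
  imports Defs "HOL-Library.FuncSet"
begin

text \<open>
  Suppose that every \<open>m\<close>-set of vertices of the host contains \<open>F\<close>. By induction along the
  construction of an iterated blowup \<open>B\<close>, every vertex set of size at least \<open>C m\<^sup>K\<close> contains \<open>B\<close>,
  where \<open>C\<close> and \<open>K\<close> depend only on \<open>B\<close>. For the step, let \<open>B\<close> have \<open>b\<close> vertices and occur in every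
  \<open>M\<close>-set. Averaging over the \<open>M\<close>-subsets of an \<open>N\<close>-set, there are at least \<open>(N/M)\<^sup>b\<close> embeddings
  of \<open>B\<close>, so some embedding of \<open>B - v\<close> extends to \<open>B\<close> in at least \<open>N/M\<^sup>b\<close> ways. Once this number
  is at least \<open>m\<close>, the possible images of \<open>v\<close> span a copy of \<open>F\<close>, which yields \<open>B(v,F)\<close>.
  A \<open>G\<close>-free host on \<open>n\<close> vertices therefore has an \<open>F\<close>-free \<open>m\<close>-set whenever \<open>C m\<^sup>K \<le> n\<close>.
\<close>

subsection \<open>Embeddings\<close>

text \<open>Encodes \<open>contains\<close> by a map from the pattern into the host, so that copies
  can be composed, restricted and glued without naming the subgraph that carries them. Non-edges of
  \<open>K\<close> impose no condition.\<close>

definition embedding :: "('a \<Rightarrow> 'b) \<Rightarrow> 'a hypergraph \<Rightarrow> 'b hypergraph \<Rightarrow> bool" where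
  "embedding \<phi> K H \<longleftrightarrow>
     inj_on \<phi> (verts K) \<and> \<phi> ` verts K \<subseteq> verts H \<and> (\<forall>e\<in>edges K. \<phi> ` e \<in> edges H)"

lemma verts_induced [simp]: "verts (induced H S) = S"
  by (simp add: induced_def)

lemma edges_induced [simp]: "edges (induced H S) = {e \<in> edges H. e \<subseteq> S}"
  by (simp add: induced_def)

lemma contains_imp_embedding:
  assumes "contains H G"
  obtains \<phi> where "embedding \<phi> G H"
proof -
  obtain K where "isomorphic K G" and sub: "subgraph K H"
    using assms unfolding contains_def by blast
  then obtain \<theta> where K: "bij_betw \<theta> (verts K) (verts G)"
    "(\<lambda>e. \<theta> ` e) ` edges K = edges G" "\<forall>e\<in>edges K. e \<subseteq> verts K"
    unfolding isomorphic_def by (elim exE conjE)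
  let ?\<phi> = "inv_into (verts K) \<theta>"
  have "?\<phi> ` (\<theta> ` e) = e" if "e \<in> edges K" for e
    using K(1,3) that by (simp add: bij_betw_def inv_into_image_cancel)
  then have "\<forall>e\<in>edges G. ?\<phi> ` e \<in> edges K"
    unfolding K(2)[symmetric] by auto
  then have "embedding ?\<phi> G H"
    using sub bij_betw_inv_into[OF K(1)]
    unfolding embedding_def subgraph_def bij_betw_def by blast
  then show thesis ..
qed

lemma embedding_imp_contains:
  assumes \<phi>: "embedding \<phi> G H" and G: "\<forall>e\<in>edges G. e \<subseteq> verts G"
  shows "contains H G"
proof -
  let ?K = "(\<phi> ` verts G, (\<lambda>e. \<phi> ` e) ` edges G)"
  let ?\<theta> = "inv_into (verts G) \<phi>"
  have inj: "inj_on \<phi> (verts G)"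
    using \<phi> by (simp add: embedding_def)
  have "?\<theta> ` (\<phi> ` e) = e" if "e \<in> edges G" for e
    using inj G that by (simp add: inv_into_image_cancel)
  then have "(\<lambda>e. ?\<theta> ` e) ` edges ?K = edges G"
    by (simp add: image_image)
  moreover have "bij_betw ?\<theta> (verts ?K) (verts G)"
    using inj by (simp add: bij_betw_inv_into inj_on_imp_bij_betw)
  ultimately have "isomorphic ?K G"
    unfolding isomorphic_def using G by (intro exI[of _ ?\<theta>]) (simp add: image_mono)
  moreover have "subgraph ?K H"
    using \<phi> by (auto simp: embedding_def subgraph_def)
  ultimately show ?thesis
    unfolding contains_def by blast
qed

lemma isomorphic_imp_embedding:
  assumes "isomorphic K G"
  obtains \<theta> where "embedding \<theta> K G"
proof -
  obtain \<theta> where \<theta>: "bij_betw \<theta> (verts K) (verts G)" "(\<lambda>e. \<theta> ` e) ` edges K = edges G"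
    using assms unfolding isomorphic_def by (elim exE conjE)
  then have "\<forall>e\<in>edges K. \<theta> ` e \<in> edges G"
    by (metis imageI)
  with \<theta>(1) have "embedding \<theta> K G"
    by (simp add: embedding_def bij_betw_def)
  then show thesis ..
qed

lemma embedding_comp:
  assumes "embedding \<theta> K G" "embedding \<phi> G H"
  shows "embedding (\<phi> \<circ> \<theta>) K H"
  using assms unfolding embedding_def
  by (auto simp: image_comp[symmetric] simp del: o_apply intro!: comp_inj_on intro: inj_on_subset)

lemma embedding_induced_mono:
  assumes "embedding \<phi> K (induced H T)" "T \<subseteq> S"
  shows "embedding \<phi> K (induced H S)"
  using assms by (simp add: embedding_def) (meson subset_trans)

lemma embedding_from_induced:
  assumes "embedding \<phi> K (induced H S)" "S \<subseteq> verts H"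
  shows "embedding \<phi> K H"
  using assms by (auto simp: embedding_def)

lemma embedding_cong:
  assumes "\<forall>e\<in>edges K. e \<subseteq> verts K" "\<And>x. x \<in> verts K \<Longrightarrow> \<phi> x = \<psi> x"
  shows "embedding \<phi> K H \<longleftrightarrow> embedding \<psi> K H"
proof -
  have "\<phi> ` e = \<psi> ` e" if "e \<in> edges K" for e
    using assms that by (intro image_cong) auto
  moreover have "\<phi> ` verts K = \<psi> ` verts K" "inj_on \<phi> (verts K) = inj_on \<psi> (verts K)"
    using assms(2) by (auto intro: image_cong simp: inj_on_def)
  ultimately show ?thesis
    by (simp add: embedding_def)
qed

subsection \<open>Counting embeddings\<close>

text \<open>The quotient of \<open>N choose M\<close> by \<open>(N - b) choose (M - b)\<close> is
  the product of (N-i)/(M-i) over i < b, and each factor is at least N/M because M \<le> N.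
  Cross-multiplying keeps everything in the natural numbers.\<close>

lemma binomial_ratio_ge_power:
  assumes "b \<le> M" "M \<le> N"
  shows "N ^ b * ((N - b) choose (M - b)) \<le> M ^ b * (N choose M)"
  using assms(1)
proof (induction b)
  case 0
  then show ?case by simp
next
  case (Suc b)
  let ?X = "(N - Suc b) choose (M - Suc b)" and ?Y = "(N - b) choose (M - b)"
  have absorb: "(M - b) * ?Y = (N - b) * ?X"
    using Suc.prems assms(2) binomial_absorption[of "M - Suc b" "N - b"]
    by (simp add: Suc_diff_Suc)
  have "N * (M - b) \<le> M * (N - b)"
    using assms(2) by (simp add: diff_mult_distrib2 mult.commute diff_le_mono2)
  then have "N * ((M - b) * ?Y) \<le> M * (N - b) * ?Y"
    by (metis mult.assoc mult_le_mono1)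
  \<comment> \<open>The factor \<open>N - b\<close> is positive here, since \<open>Suc b\<close>
    \<le> M \<le> N, and cancels in the next step.\<close>
  then have "(N - b) * (N * ?X) \<le> (N - b) * (M * ?Y)"
    unfolding absorb by (simp only: ac_simps)
  then have step: "N * ?X \<le> M * ?Y"
    using Suc.prems assms(2) by simp
  have "N ^ Suc b * ?X = N ^ b * (N * ?X)"
    by (simp add: ac_simps)
  also have "\<dots> \<le> N ^ b * (M * ?Y)"
    using step by simp
  also have "\<dots> = M * (N ^ b * ?Y)"
    by (simp add: ac_simps)
  also have "\<dots> \<le> M * (M ^ b * (N choose M))"
    using Suc by simp
  finally show ?case
    by (simp add: ac_simps)
qed

lemma card_supersets:
  assumes "finite S" "U \<subseteq> S" "card U \<le> M"
  shows "card {T. T \<subseteq> S \<and> card T = M \<and> U \<subseteq> T} = (card S - card U) choose (M - card U)"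
proof -
  have U: "finite U"
    using assms finite_subset by blast
  have "bij_betw (\<lambda>T. T - U) {T. T \<subseteq> S \<and> card T = M \<and> U \<subseteq> T}
          {T. T \<subseteq> S - U \<and> card T = M - card U}"
  proof (rule bij_betw_byWitness[where f' = "\<lambda>T. T \<union> U"])
    show "(\<lambda>T. T \<union> U) ` {T. T \<subseteq> S - U \<and> card T = M - card U}
            \<subseteq> {T. T \<subseteq> S \<and> card T = M \<and> U \<subseteq> T}"
    proof clarify
      fix T assume T: "T \<subseteq> S - U" "card T = M - card U"
      then have "finite T" "T \<inter> U = {}"
        using assms(1) by (auto intro: finite_subset)
      then have "card (T \<union> U) = M"
        using T U assms(3) by (simp add: card_Un_disjoint)
      then show "T \<union> U \<subseteq> S \<and> card (T \<union> U) = M \<and> U \<subseteq> T \<union> U"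
        using T assms(2) by auto
    qed
  qed (use U in \<open>auto simp: card_Diff_subset\<close>)
  then show ?thesis
    using assms U by (simp add: bij_betw_same_card n_subsets card_Diff_subset)
qed

text \<open>Double counting, with N = |S| and b = |V|. If all fibres had fewer than \<open>m\<close>
  points, then |E| \<le> N^(b-1) (m-1). Conversely, each \<open>M\<close>-set contains the image of
  a member of \<open>E\<close>, and each image lies in exactly \<open>(N - b) choose (M - b)\<close>
  of the \<open>M\<close>-sets, so |E| \<ge> (N/M)^b. Together these give N \<le> (m-1) M^b, against
  \<open>large\<close>.\<close>

lemma exists_rich_fibre:
  fixes E :: "('a \<Rightarrow> 'b) set"
  assumes S: "finite S" and V: "finite V" "v \<in> V"
    and E: "E \<subseteq> V \<rightarrow>\<^sub>E S" "\<And>\<phi>. \<phi> \<in> E \<Longrightarrow> inj_on \<phi> V"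
    and hit: "\<And>T. T \<subseteq> S \<Longrightarrow> card T = M \<Longrightarrow> \<exists>\<phi>\<in>E. \<phi> ` V \<subseteq> T"
    and pos: "M > 0" "m > 0" and large: "m * M ^ card V \<le> card S"
  shows "\<exists>\<psi>. m \<le> card {x \<in> S. \<psi>(v := x) \<in> E}"
proof (rule ccontr)
  assume "\<nexists>\<psi>. m \<le> card {x \<in> S. \<psi>(v := x) \<in> E}"
  then have small: "card {x \<in> S. \<psi>(v := x) \<in> E} \<le> m - 1" for \<psi>
    by (metis Suc_pred' less_Suc_eq_le linorder_not_le pos(2))
  define N b where "N = card S" and "b = card V"
  have b: "b > 0"
    using V by (auto simp: b_def card_gt_0_iff)
  have "M \<le> M ^ b"
    using pos b by (simp add: self_le_power)
  also have "\<dots> \<le> m * M ^ b"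
    using pos by simp
  finally have MN: "M \<le> N"
    using large by (simp add: N_def b_def)
  \<comment> \<open>A single \<open>M\<close>-set already contains an injective image of
    \<open>V\<close>, which forces b \<le> M.\<close>
  then obtain T where "T \<subseteq> S" "card T = M"
    using obtain_subset_with_card_n unfolding N_def by metis
  with hit obtain \<phi> where "\<phi> \<in> E" "\<phi> ` V \<subseteq> T"
    by blast
  then have bM: "b \<le> M"
    using \<open>T \<subseteq> S\<close> \<open>card T = M\<close> S E(2) card_inj_on_le finite_subset unfolding b_def by metis
  have finE: "finite E"
    using E(1) S V finite_PiE by (metis finite_subset)
  let ?P = "(V - {v}) \<rightarrow>\<^sub>E S"
  let ?A = "\<lambda>\<psi>. {x \<in> S. \<psi>(v := x) \<in> E}"
  have finP: "finite ?P"
    using S V by (intro finite_PiE) auto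
  have "E \<subseteq> (\<Union>\<psi>\<in>?P. (\<lambda>x. \<psi>(v := x)) ` ?A \<psi>)"
  proof
    fix \<phi> assume \<phi>: "\<phi> \<in> E"
    then have ext: "\<phi> \<in> V \<rightarrow>\<^sub>E S"
      using E by blast
    \<comment> \<open>The value \<open>undefined\<close> at \<open>v\<close> makes
      \<open>\<psi>\<close> extensional on \<open>V - {v}\<close>, hence one of at most N^(b-1)
      functions.\<close>
    define \<psi> where "\<psi> = \<phi>(v := undefined)"
    have "\<psi> \<in> ?P" "\<phi> v \<in> S" "\<psi>(v := \<phi> v) = \<phi>"
      using ext V by (auto simp: \<psi>_def PiE_iff extensional_def)
    then show "\<phi> \<in> (\<Union>\<psi>\<in>?P. (\<lambda>x. \<psi>(v := x)) ` ?A \<psi>)"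
      using \<phi> by (intro UN_I[of \<psi>] image_eqI[of _ _ "\<phi> v"]) auto
  qed
  then have "card E \<le> card (\<Union>\<psi>\<in>?P. (\<lambda>x. \<psi>(v := x)) ` ?A \<psi>)"
    using S finP by (intro card_mono) auto
  also have "\<dots> \<le> (\<Sum>\<psi>\<in>?P. card ((\<lambda>x. \<psi>(v := x)) ` ?A \<psi>))"
    using finP by (rule card_UN_le)
  also have "\<dots> \<le> (\<Sum>\<psi>\<in>?P. m - 1)"
    using S by (intro sum_mono order_trans[OF card_image_le small]) simp
  also have "\<dots> = N ^ (b - 1) * (m - 1)"
    using V by (simp add: card_funcsetE N_def b_def card_Diff_singleton)
  finally have upper: "card E \<le> N ^ (b - 1) * (m - 1)" .
  let ?X = "(N - b) choose (M - b)"
  let ?Q = "\<lambda>\<phi>. {T. T \<subseteq> S \<and> card T = M \<and> \<phi> ` V \<subseteq> T}"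
  have finQ: "finite (?Q \<phi>)" for \<phi>
    using S by (auto intro: finite_subset[of _ "Pow S"])
  have cardQ: "card (?Q \<phi>) = ?X" if "\<phi> \<in> E" for \<phi>
  proof -
    have "card (\<phi> ` V) = b" "\<phi> ` V \<subseteq> S"
      using that E by (auto simp: b_def card_image)
    then show ?thesis
      using card_supersets[of S "\<phi> ` V" M] S bM by (simp add: N_def)
  qed
  have "N choose M = card {T. T \<subseteq> S \<and> card T = M}"
    using S by (simp add: n_subsets N_def)
  also have "\<dots> \<le> card (\<Union>\<phi>\<in>E. ?Q \<phi>)"
    using hit finE finQ by (intro card_mono) auto
  also have "\<dots> \<le> (\<Sum>\<phi>\<in>E. card (?Q \<phi>))"
    using finE by (rule card_UN_le)
  also have "\<dots> = card E * ?X"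
    using cardQ by simp
  finally have lower: "N choose M \<le> card E * ?X" .
  have "N ^ b * ?X \<le> M ^ b * (N choose M)"
    using bM MN by (rule binomial_ratio_ge_power)
  also have "\<dots> \<le> M ^ b * (N ^ (b - 1) * (m - 1) * ?X)"
    using lower upper by (meson le_trans mult_le_mono1 mult_le_mono2)
  finally have "N ^ (b - 1) * ?X * N \<le> N ^ (b - 1) * ?X * ((m - 1) * M ^ b)"
    using b by (cases b) (simp_all add: ac_simps)
  \<comment> \<open>Positivity of the common factor, which rests on 0 < M \<le> N, allows its
    cancellation.\<close>
  moreover have "N ^ (b - 1) * ?X > 0"
    using MN pos by simp
  ultimately have "N \<le> (m - 1) * M ^ b"
    using mult_le_cancel1 by blast
  also have "\<dots> < m * M ^ b"
    using pos by simp
  finally show False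
    using large by (simp add: N_def b_def)
qed

subsection \<open>Iterated blowups in dense hosts\<close>

lemma iterated_blowup_wf:
  assumes "iterated_blowup F B" "finite (verts F)"
  shows "finite (verts B) \<and> (\<forall>e\<in>edges B. e \<subseteq> verts B)"
  using assms(1)
proof induction
  case (base H)
  then show ?case
    using assms(2) by (auto simp: isomorphic_def bij_betw_finite)
next
  case (step H v H')
  then show ?case
    unfolding vertex_blowup_def by fastforce
qed

text \<open>The copy of \<open>F\<close> inside \<open>A\<close> places \<open>v\<close> and its
  clones, and \<open>\<psi>\<close> places all other vertices. An edge of \<open>B\<close> through
  \<open>v\<close>, or a copy of one, has a single vertex u in \<open>insert v W\<close>, so it is
  mapped exactly as the embedding \<open>\<psi>(v := \<chi> u)\<close> maps the original edge. Edges
  in \<open>D\<close> are handled by the copy of \<open>F\<close>.\<close>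

lemma vertex_blowup_embedding:
  assumes B: "\<forall>e\<in>edges B. e \<subseteq> verts B" "v \<in> verts B"
    and blowup: "vertex_blowup B v F B'"
    and A: "\<And>x. x \<in> A \<Longrightarrow> embedding (\<psi>(v := x)) B H"
    and F: "embedding \<phi> F (induced H A)"
  obtains \<phi>' where "embedding \<phi>' B' H"
proof -
  obtain W D where WD: "W \<inter> verts B = {}" "D \<subseteq> Pow (insert v W)"
    and B': "B' = (verts B \<union> W,
        edges B \<union> {insert u (e - {v}) |e u. e \<in> edges B \<and> v \<in> e \<and> u \<in> W} \<union> D)"
    and iso: "isomorphic (induced B' (insert v W)) F"
    using blowup unfolding vertex_blowup_def by blast
  obtain \<theta> where "embedding \<theta> (induced B' (insert v W)) F"
    using iso by (rule isomorphic_imp_embedding)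
  then have "embedding (\<phi> \<circ> \<theta>) (induced B' (insert v W)) (induced H A)"
    using F by (rule embedding_comp)
  then obtain \<chi> where \<chi>: "embedding \<chi> (induced B' (insert v W)) (induced H A)"
    by blast
  have \<chi>_inj: "inj_on \<chi> (insert v W)" and \<chi>_A: "\<And>u. u \<in> insert v W \<Longrightarrow> \<chi> u \<in> A"
    using \<chi> by (auto simp: embedding_def)
  define \<Phi> where "\<Phi> x = (if x \<in> insert v W then \<chi> x else \<psi> x)" for x
  have emb: "embedding (\<psi>(v := \<chi> u)) B H" if "u \<in> insert v W" for u
    using A \<chi>_A that by blast
  have \<Phi>_copy: "\<Phi> ` insert u (e - {v}) = (\<psi>(v := \<chi> u)) ` e"
    if "e \<in> edges B" "v \<in> e" "u \<in> insert v W" for e u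
  proof -
    have "\<Phi> ` (e - {v}) = \<psi> ` (e - {v})"
      using that B WD by (intro image_cong) (auto simp: \<Phi>_def)
    moreover have "\<Phi> u = \<chi> u"
      using that by (simp add: \<Phi>_def)
    moreover have "(\<psi>(v := \<chi> u)) ` (e - {v}) = \<psi> ` (e - {v})"
      by (intro image_cong) auto
    moreover have "(\<psi>(v := \<chi> u)) ` e = insert (\<chi> u) ((\<psi>(v := \<chi> u)) ` (e - {v}))"
      using that(2) by (metis fun_upd_same image_insert insert_Diff)
    ultimately show ?thesis
      by simp
  qed
  have "\<Phi> ` e \<in> edges H" if e: "e \<in> edges B'" for e
  proof -
    consider "e \<in> edges B" "v \<notin> e" | "e \<in> edges B" "v \<in> e"
      | e' u where "e = insert u (e' - {v})" "e' \<in> edges B" "v \<in> e'" "u \<in> W"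
      | "e \<in> D"
      using e B' by auto
    then show ?thesis
    proof cases
      case 1
      \<comment> \<open>An edge avoiding \<open>v\<close> sees only \<open>\<psi>\<close>; the value
        \<open>\<chi> v\<close> merely completes \<open>\<psi>\<close> to an embedding.\<close>
      then have "\<Phi> ` e = (\<psi>(v := \<chi> v)) ` e"
        using B WD by (intro image_cong) (auto simp: \<Phi>_def)
      then show ?thesis
        using emb[of v] 1 unfolding embedding_def by (metis insertI1)
    next
      case 2
      then show ?thesis
        using \<Phi>_copy[of e v] emb[of v] unfolding embedding_def by (metis insertI1 insert_Diff)
    next
      case 3
      then show ?thesis
        using \<Phi>_copy[of e' u] emb[of u] unfolding embedding_def by (metis insertCI)
    next
      case 4
      then have "\<Phi> ` e = \<chi> ` e"
        using WD by (intro image_cong) (auto simp: \<Phi>_def)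
      moreover have "e \<in> edges (induced B' (insert v W))"
        using 4 WD B' by auto
      ultimately show ?thesis
        using \<chi> by (auto simp: embedding_def)
    qed
  qed
  moreover have "inj_on \<Phi> (verts B')"
  proof -
    have "inj_on \<Phi> (insert v W)"
      using \<chi>_inj by (simp add: \<Phi>_def inj_on_def)
    moreover have "inj_on \<Phi> (verts B - {v})"
    proof -
      have "inj_on (\<psi>(v := \<chi> v)) (verts B - {v})"
        using emb[of v] by (auto simp: embedding_def intro: inj_on_subset)
      moreover have "\<Phi> x = (\<psi>(v := \<chi> v)) x" if "x \<in> verts B - {v}" for x
        using that WD by (auto simp: \<Phi>_def)
      ultimately show ?thesis
        using inj_on_cong by metis
    qed
    \<comment> \<open>The point \<open>\<chi> u\<close> differs from \<open>\<psi> x\<close> because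
      \<open>\<psi>(v := \<chi> u)\<close> is injective on all of \<open>B\<close>.\<close>
    moreover have "\<Phi> u \<noteq> \<Phi> x" if "u \<in> insert v W" "x \<in> verts B - {v}" for u x
    proof -
      have "(\<psi>(v := \<chi> u)) v \<noteq> (\<psi>(v := \<chi> u)) x"
        using emb[OF that(1)] that(2) B(2) inj_onD[of "\<psi>(v := \<chi> u)" "verts B" v x]
        unfolding embedding_def by blast
      moreover have "x \<notin> insert v W"
        using that WD by auto
      ultimately show ?thesis
        using that by (simp add: \<Phi>_def)
    qed
    ultimately have "inj_on \<Phi> (insert v W \<union> (verts B - {v}))"
      unfolding inj_on_Un by blast
    moreover have "verts B' = insert v W \<union> (verts B - {v})"
      using B' B(2) by auto
    ultimately show ?thesis
      by simp
  qed
  moreover have "\<Phi> ` verts B' \<subseteq> verts H"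
  proof
    fix y assume "y \<in> \<Phi> ` verts B'"
    then obtain x where x: "x \<in> verts B'" "y = \<Phi> x"
      by blast
    show "y \<in> verts H"
    proof (cases "x \<in> insert v W")
      case True
      then have "(\<psi>(v := \<chi> x)) v \<in> verts H"
        using emb B(2) by (auto simp: embedding_def)
      then show ?thesis
        using x True by (simp add: \<Phi>_def)
    next
      case False
      then have "(\<psi>(v := \<chi> v)) x \<in> verts H"
        using emb[of v] x B' by (auto simp: embedding_def)
      then show ?thesis
        using x False by (simp add: \<Phi>_def)
    qed
  qed
  ultimately have "embedding \<Phi> B' H"
    by (simp add: embedding_def)
  then show thesis ..
qed

text \<open>\<open>C\<close> and \<open>K\<close> are chosen before the host, \<open>m\<close> and
  \<open>S\<close>, so they depend only on the blowup. The claim covers every large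
  \<open>S\<close>, not just the whole host, because the induction step applies it to all
  \<open>M\<close>-subsets of \<open>S\<close>.\<close>

lemma iterated_blowup_in_large_sets:
  fixes F :: "'a hypergraph" and B :: "'v hypergraph"
  assumes "iterated_blowup F B" and F: "finite (verts F)"
  shows "\<exists>C K. C > 0 \<and> K > 0 \<and>
    (\<forall>(H :: 'h hypergraph) m S. m > 0 \<longrightarrow> finite (verts H) \<longrightarrow>
       (\<forall>T\<subseteq>verts H. card T = m \<longrightarrow> (\<exists>\<phi>. embedding \<phi> F (induced H T))) \<longrightarrow>
       S \<subseteq> verts H \<longrightarrow> C * m ^ K \<le> card S \<longrightarrow> (\<exists>\<phi>. embedding \<phi> B (induced H S)))"
  using assms(1)
proof induction
  case (base B)
  obtain \<theta> where \<theta>: "embedding \<theta> B F"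
    using base by (rule isomorphic_imp_embedding)
  show ?case
  proof (intro exI[of _ "1::nat"] conjI allI impI)
    fix H :: "'h hypergraph" and m :: nat and S
    assume hyp: "\<forall>T\<subseteq>verts H. card T = m \<longrightarrow> (\<exists>\<phi>. embedding \<phi> F (induced H T))"
      and S: "S \<subseteq> verts H" "1 * m ^ 1 \<le> card S"
    obtain T where T: "T \<subseteq> S" "card T = m"
      using S(2) by (metis mult_1 obtain_subset_with_card_n power_one_right)
    then obtain \<phi> where "embedding \<phi> F (induced H T)"
      using hyp S(1) by blast
    then have "embedding (\<phi> \<circ> \<theta>) B (induced H S)"
      using embedding_comp[OF \<theta>] embedding_induced_mono T(1) by blast
    then show "\<exists>\<phi>. embedding \<phi> B (induced H S)"
      by blast
  qed auto
next
  case (step B v B')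
  have wf: "finite (verts B)" "\<forall>e\<in>edges B. e \<subseteq> verts B"
    using iterated_blowup_wf[OF step.hyps(1) F] by auto
  obtain C K where CK: "C > 0" "K > 0"
    and IH: "\<And>(H :: 'h hypergraph) m S. m > 0 \<Longrightarrow> finite (verts H) \<Longrightarrow>
       \<forall>T\<subseteq>verts H. card T = m \<longrightarrow> (\<exists>\<phi>. embedding \<phi> F (induced H T)) \<Longrightarrow>
       S \<subseteq> verts H \<Longrightarrow> C * m ^ K \<le> card S \<Longrightarrow> \<exists>\<phi>. embedding \<phi> B (induced H S)"
    using step.IH by blast
  define b where "b = card (verts B)"
  show ?case
  \<comment> \<open>With M = C m^K, the size m M^b required for a rich fibre equals C^b
    m^(Kb+1).\<close>
  proof (rule exI[of _ "C ^ b"], rule exI[of _ "Suc (K * b)"], intro conjI allI impI)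
    fix H :: "'h hypergraph" and m :: nat and S
    assume m: "m > 0" and H: "finite (verts H)"
      and hyp: "\<forall>T\<subseteq>verts H. card T = m \<longrightarrow> (\<exists>\<phi>. embedding \<phi> F (induced H T))"
      and S: "S \<subseteq> verts H" "C ^ b * m ^ Suc (K * b) \<le> card S"
    define M where "M = C * m ^ K"
    define E where "E = {\<phi> \<in> verts B \<rightarrow>\<^sub>E S. embedding \<phi> B (induced H S)}"
    have "\<exists>\<psi>. m \<le> card {x \<in> S. \<psi>(v := x) \<in> E}"
    proof (rule exists_rich_fibre[where M = M])
      show "\<exists>\<phi>\<in>E. \<phi> ` verts B \<subseteq> T" if T: "T \<subseteq> S" "card T = M" for T
      proof -
        obtain \<phi> where \<phi>: "embedding \<phi> B (induced H T)"
          using IH[OF m H hyp, of T] T S(1) by (auto simp: M_def)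
        \<comment> \<open>Restriction gives an extensional map, so that \<open>E\<close> is a set of
          functions that can be counted.\<close>
        let ?\<phi> = "restrict \<phi> (verts B)"
        have \<phi>': "embedding ?\<phi> B (induced H T)"
          using \<phi> embedding_cong[OF wf(2), of ?\<phi> \<phi>] by simp
        then have "?\<phi> ` verts B \<subseteq> T"
          by (simp add: embedding_def)
        moreover have "?\<phi> \<in> E"
          using \<phi>' calculation T(1) embedding_induced_mono
          unfolding E_def by (fastforce simp: PiE_iff)
        ultimately show ?thesis
          by blast
      qed
      show "m * M ^ card (verts B) \<le> card S"
        using S(2) by (simp add: M_def b_def power_mult_distrib power_mult ac_simps)
      show "finite S"
        using S(1) H by (rule finite_subset)
    qed (use wf step.hyps m CK in \<open>auto simp: E_def M_def embedding_def\<close>)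
    then obtain \<psi> where "m \<le> card {x \<in> S. \<psi>(v := x) \<in> E}"
      by blast
    then obtain A where A: "A \<subseteq> {x \<in> S. \<psi>(v := x) \<in> E}" "card A = m"
      by (rule obtain_subset_with_card_n)
    then obtain \<phi> where "embedding \<phi> F (induced H A)"
      using hyp S(1) by blast
    moreover have "A \<subseteq> S"
      using A(1) by blast
    \<comment> \<open>The blowup is built with \<open>induced H S\<close> as host, which keeps the
      new copy inside \<open>S\<close>.\<close>
    ultimately have "embedding \<phi> F (induced (induced H S) A)"
      by (simp add: embedding_def) (meson subset_trans)
    moreover have "embedding (\<psi>(v := x)) B (induced H S)" if "x \<in> A" for x
      using A that by (auto simp: E_def)
    ultimately show "\<exists>\<phi>. embedding \<phi> B' (induced H S)"
      using vertex_blowup_embedding[OF wf(2) step.hyps(2,3)] by metis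
  qed (use CK in auto)
qed

section \<open>From polynomial thresholds to a power lower bound\<close>

theorem theorem1p2:
  fixes r :: nat and F :: "'a hypergraph" and G :: "'b hypergraph"
  assumes "r \<ge> 2"
    and "rgraph r F"
    and "rgraph r G"
    and "\<exists>B :: nat hypergraph. iterated_blowup F B \<and> contains B G"
  shows "\<exists>c :: real. c > 0 \<and>
           (\<forall>\<^sub>F n in sequentially. real (f_max r F G n) \<ge> real n powr c)"
proof -
  obtain B :: "nat hypergraph" where B: "iterated_blowup F B" "contains B G"
    using assms(4) by blast
  have F: "finite (verts F)" "\<forall>e\<in>edges F. e \<subseteq> verts F" and G: "\<forall>e\<in>edges G. e \<subseteq> verts G"
    using assms by (auto simp: rgraph_def)
  obtain \<gamma> where \<gamma>: "embedding \<gamma> G B"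
    using B(2) by (rule contains_imp_embedding)
  obtain C K :: nat where CK: "C > 0" "K > 0"
    and large: "\<And>(H :: nat hypergraph) m S. m > 0 \<Longrightarrow> finite (verts H) \<Longrightarrow>
       \<forall>T\<subseteq>verts H. card T = m \<longrightarrow> (\<exists>\<phi>. embedding \<phi> F (induced H T)) \<Longrightarrow>
       S \<subseteq> verts H \<Longrightarrow> C * m ^ K \<le> card S \<Longrightarrow> \<exists>\<phi>. embedding \<phi> B (induced H S)"
    using iterated_blowup_in_large_sets[OF B(1) F(1), where 'h = nat] by blast
  have f_max_ge: "m \<le> f_max r F G n" if m: "m > 0" "C * m ^ K \<le> n" for m n
  proof -
    have "m \<le> m ^ K"
      using m(1) CK(2) by (simp add: self_le_power)
    also have "\<dots> \<le> C * m ^ K"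
      using CK(1) by simp
    finally have "m \<le> n"
      using m(2) by simp
    moreover have "\<exists>S\<subseteq>verts H. card S = m \<and> free_of F (induced H S)"
      if H: "rgraph r H" "card (verts H) = n" "free_of G H" for H :: "nat hypergraph"
    proof (rule ccontr)
      assume "\<not> ?thesis"
      then have "\<forall>T\<subseteq>verts H. card T = m \<longrightarrow> (\<exists>\<phi>. embedding \<phi> F (induced H T))"
        unfolding free_of_def by (metis contains_imp_embedding)
      then obtain \<phi> where "embedding \<phi> B (induced H (verts H))"
        using large[of m H "verts H"] m H by (auto simp: rgraph_def)
      then have "embedding (\<phi> \<circ> \<gamma>) G H"
        using embedding_comp[OF \<gamma>] embedding_from_induced by blast
      then show False
        using embedding_imp_contains[OF _ G] H(3) unfolding free_of_def by blast
    qed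
    ultimately show ?thesis
      unfolding f_max_def by (intro Max_ge) (auto intro: finite_subset[of _ "{..n}"])
  qed
  \<comment> \<open>For m \<le> 2 n^c the threshold C m^K is at most C 2^K n^(cK). Since 1 - cK = c,
    a factor n^c remains to absorb the constant C 2^K once n is large.\<close>
  define c where "c = 1 / (real K + 1)"
  have c: "c > 0" "c + c * real K = 1"
    by (auto simp: c_def field_simps)
  have "\<forall>\<^sub>F n in sequentially. real C * 2 ^ K * real n powr (c * real K) \<le> real n"
    using eventually_ge_at_top[of "nat \<lceil>(real C * 2 ^ K) powr (1 / c)\<rceil>"] eventually_gt_at_top[of 0]
  proof eventually_elim
    case (elim n)
    then have "(real C * 2 ^ K) powr (1 / c) \<le> real n"
      by linarith
    then have "((real C * 2 ^ K) powr (1 / c)) powr c \<le> real n powr c"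
      using c(1) by (intro powr_mono2) auto
    then have "real C * 2 ^ K \<le> real n powr c"
      using c(1) CK(1) by (simp add: powr_powr)
    then have "real C * 2 ^ K * real n powr (c * real K) \<le> real n powr c * real n powr (c * real K)"
      by (rule mult_right_mono) simp
    also have "\<dots> = real n"
      using elim(2) by (simp add: powr_add[symmetric] c(2))
    finally show ?case .
  qed
  then have "\<forall>\<^sub>F n in sequentially. real (f_max r F G n) \<ge> real n powr c"
    using eventually_gt_at_top[of 0]
  proof eventually_elim
    case (elim n)
    define m where "m = nat \<lceil>real n powr c\<rceil>"
    have ge1: "real n powr c \<ge> 1"
      using elim(2) c(1) by (intro ge_one_powr_ge_zero) auto
    \<comment> \<open>Rounding up at most doubles a number that is at least 1.\<close>
    have m: "real n powr c \<le> real m" "real m \<le> 2 * real n powr c"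
      using ge1 unfolding m_def by linarith+
    have "real (C * m ^ K) \<le> real C * (2 * real n powr c) ^ K"
      using power_mono[OF m(2), of K] by (simp add: mult_left_mono)
    also have "\<dots> = real C * 2 ^ K * real n powr (c * real K)"
      using elim(2) by (simp add: power_mult_distrib powr_powr powr_realpow[symmetric])
    also have "\<dots> \<le> real n"
      by (rule elim(1))
    finally have "C * m ^ K \<le> n"
      by (simp only: of_nat_le_iff)
    moreover have "m > 0"
      using m(1) ge1 by linarith
    ultimately have "m \<le> f_max r F G n"
      by (intro f_max_ge)
    then show ?case
      using m(1) by linarith
  qed
  then show ?thesis
    using c(1) by blast
qed

end
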